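(* Let $X$ and $Y$ be two rearrangement invariant sequence spaces with the Fatou property. Then, up to the equivalence of norms, the space $M(X,Y)$ is rearrangement invariant as well.
   Context: A Köthe sequence space is a Banach space $X$ that is a linear subspace of the space of all (real or complex) sequences, with $|x|\le|y|$ coordinatewise and $y\in X$ implying $x\in X$, $\|x\|_X\le\|y\|_X$, and containing all finitely supported sequences. It is rearrangement invariant if $x$ equi-measurable (w.r.t. counting measure on $\mathbb N$, i.e. $|x|$ and $|y|$ have the same distribution function) with $y\in X$ implies $x\in X$ and $\|x\|_X=\|y\|_X$. Fatou property: the closed unit ball is closed under coordinatewise convergence. $M(X,Y)=\{g:fg\in Y\ \forall f\in X\}$ with norm $\|g\|_{M(X,Y)}=\sup_{\|f\|_X\le1}\|fg\|_Y$. *)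

theory Defs
  imports "HOL-Analysis.Analysis"
begin

text \<open>The scalar field is a type of class \<^class>\<open>real_normed_field\<close>; by the Gelfand-Mazur theorem
  this means the reals or the complex numbers with the usual absolute value. A sequence space is
  given by its carrier \<open>X\<close> and its norm \<open>nrm\<close>, whose values outside \<open>X\<close> are irrelevant.\<close>

locale normed_sequence_space =
  fixes X :: "(nat \<Rightarrow> 'a :: {real_normed_field, banach}) set"
    and nrm :: "(nat \<Rightarrow> 'a) \<Rightarrow> real"
  assumes zero_mem: "(\<lambda>n. 0) \<in> X"
    and add_mem: "\<And>x y. x \<in> X \<Longrightarrow> y \<in> X \<Longrightarrow> (\<lambda>n. x n + y n) \<in> X"
    and scale_mem: "\<And>c x. x \<in> X \<Longrightarrow> (\<lambda>n. c * x n) \<in> X"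
    and nrm_nonneg: "\<And>x. x \<in> X \<Longrightarrow> 0 \<le> nrm x"
    and nrm_eq_0_iff: "\<And>x. x \<in> X \<Longrightarrow> nrm x = 0 \<longleftrightarrow> x = (\<lambda>n. 0)"
    and nrm_scale: "\<And>c x. x \<in> X \<Longrightarrow> nrm (\<lambda>n. c * x n) = norm c * nrm x"
    and nrm_triangle: "\<And>x y. x \<in> X \<Longrightarrow> y \<in> X \<Longrightarrow> nrm (\<lambda>n. x n + y n) \<le> nrm x + nrm y"

locale banach_sequence_space = normed_sequence_space +
  assumes complete:
    "\<And>u. (\<And>k. u k \<in> X) \<Longrightarrow>
         (\<And>e. 0 < e \<Longrightarrow> \<exists>K. \<forall>j\<ge>K. \<forall>k\<ge>K. nrm (\<lambda>n. u j n - u k n) < e) \<Longrightarrow>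
         \<exists>x\<in>X. (\<lambda>k. nrm (\<lambda>n. u k n - x n)) \<longlonglongrightarrow> 0"

locale koethe_sequence_space = banach_sequence_space +
  assumes solid_mem: "\<And>x y. y \<in> X \<Longrightarrow> (\<And>n. norm (x n) \<le> norm (y n)) \<Longrightarrow> x \<in> X"
    and nrm_mono: "\<And>x y. y \<in> X \<Longrightarrow> (\<And>n. norm (x n) \<le> norm (y n)) \<Longrightarrow> nrm x \<le> nrm y"
    and finite_support_mem: "\<And>x. finite {n. x n \<noteq> 0} \<Longrightarrow> x \<in> X"

definition distribution_function :: "(nat \<Rightarrow> 'a :: real_normed_vector) \<Rightarrow> real \<Rightarrow> ennreal" where
  "distribution_function x t = emeasure (count_space UNIV) {n. t < norm (x n)}"

definition equimeasurable ::
    "(nat \<Rightarrow> 'a :: real_normed_vector) \<Rightarrow> (nat \<Rightarrow> 'a) \<Rightarrow> bool" where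
  "equimeasurable x y \<longleftrightarrow> (\<forall>t\<ge>0. distribution_function x t = distribution_function y t)"

locale ri_sequence_space = koethe_sequence_space +
  assumes equimeasurable_mem: "\<And>x y. equimeasurable x y \<Longrightarrow> y \<in> X \<Longrightarrow> x \<in> X"
    and equimeasurable_nrm: "\<And>x y. equimeasurable x y \<Longrightarrow> y \<in> X \<Longrightarrow> nrm x = nrm y"

definition fatou_property ::
    "(nat \<Rightarrow> 'a :: real_normed_vector) set \<Rightarrow> ((nat \<Rightarrow> 'a) \<Rightarrow> real) \<Rightarrow> bool" where
  "fatou_property X nrm \<longleftrightarrow>
     (\<forall>u x. (\<forall>k. u k \<in> X \<and> nrm (u k) \<le> 1) \<and> (\<forall>n. (\<lambda>k. u k n) \<longlonglongrightarrow> x n)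
        \<longrightarrow> x \<in> X \<and> nrm x \<le> 1)"

definition multipliers ::
    "(nat \<Rightarrow> 'a :: real_normed_field) set \<Rightarrow> (nat \<Rightarrow> 'a) set \<Rightarrow> (nat \<Rightarrow> 'a) set" where
  "multipliers X Y = {g. \<forall>f\<in>X. (\<lambda>n. f n * g n) \<in> Y}"

text \<open>The supremum is taken in the reals. It is a genuine one whenever \<open>X\<close> and \<open>Y\<close> are Koethe
  sequence spaces and \<open>g\<close> is a multiplier, since multiplication by \<open>g\<close> is then a bounded operator.\<close>

definition multiplier_norm ::
    "(nat \<Rightarrow> 'a :: real_normed_field) set \<Rightarrow> ((nat \<Rightarrow> 'a) \<Rightarrow> real) \<Rightarrow> ((nat \<Rightarrow> 'a) \<Rightarrow> real) \<Rightarrow>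
     (nat \<Rightarrow> 'a) \<Rightarrow> real" where
  "multiplier_norm X nX nY g = (SUP f\<in>{f \<in> X. nX f \<le> 1}. nY (\<lambda>n. f n * g n))"

definition equivalent_norms_on ::
    "'b set \<Rightarrow> ('b \<Rightarrow> real) \<Rightarrow> ('b \<Rightarrow> real) \<Rightarrow> bool" where
  "equivalent_norms_on V N N' \<longleftrightarrow>
     (\<exists>c>0. \<exists>C>0. \<forall>x\<in>V. c * N x \<le> N' x \<and> N' x \<le> C * N x)"

end

theory Submission
  imports Defs
begin

text \<open>
  Two facts carry the proof. The first is that the multiplier space \<open>M(X,Y)\<close> with its own norm is
  always a Koethe sequence space (\<open>koethe_pair.koethe_multipliers\<close>); the point is that every
  multiplier acts boundedly, which a gliding hump argument derives from the completeness of \<open>X\<close>.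

  The second fact is a transplantation principle (\<open>ri_pair.multiplier_transplant\<close>): if \<open>g\<close> is
  supported on \<open>S\<close> and dominated by \<open>h \<circ> \<tau>\<close> there, for an injection \<open>\<tau>\<close> on \<open>S\<close>, and if \<open>h\<close> is a
  multiplier, then so is \<open>g\<close>, with at most the norm of \<open>h\<close>. Indeed a test sequence \<open>f\<close> for \<open>g\<close> can be
  moved along \<open>\<tau>\<close> to a test sequence for \<open>h\<close> without increasing its norm in \<open>X\<close>, and the product with
  \<open>h\<close> then dominates a copy of \<open>f g\<close> moved along \<open>\<tau>\<close>.

  There remain two cases. If all multipliers tend to \<open>0\<close>, then the level sets of two equimeasurable
  multipliers, except the level set of \<open>0\<close>, are finite and have equal cardinalities. Hence there is
  a bijection between the supports that matches the absolute values, and transplantation in both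
  directions shows that the multiplier norm itself is rearrangement invariant. Otherwise some
  multiplier is bounded away from \<open>0\<close> on an infinite set, and transplantation from this set to all of
  \<open>\<nat>\<close> makes the constant sequence \<open>1\<close> a multiplier. Then \<open>M(X,Y)\<close> consists exactly of the bounded
  sequences, and the supremum norm is an equivalent rearrangement invariant norm. In this second
  case two equimeasurable sequences need not be related by any injection that matches absolute
  values, as \<open>1\<close> and \<open>1 - 1/n\<close> show, which is why the norm is changed.
\<close>

section \<open>Koethe sequence spaces\<close>

abbreviation unit_seq :: "nat \<Rightarrow> nat \<Rightarrow> 'a :: zero_neq_one" where
  "unit_seq k \<equiv> (\<lambda>n. if n = k then 1 else 0)"

context normed_sequence_space
begin

lemma diff_mem: "x \<in> X \<Longrightarrow> y \<in> X \<Longrightarrow> (\<lambda>n. x n - y n) \<in> X"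
  using add_mem[of x "\<lambda>n. -1 * y n"] scale_mem[of y "-1"] by simp

lemma nrm_zero: "nrm (\<lambda>n. 0) = 0"
  using nrm_eq_0_iff zero_mem by blast

end

text \<open>Passes completeness from the multiplier norm to the supremum norm in the bounded case.\<close>

lemma banach_sequence_space_equivalent_norm:
  fixes X :: "(nat \<Rightarrow> 'a :: {real_normed_field, banach}) set"
  assumes "banach_sequence_space X N" and "normed_sequence_space X N'"
    and eqv: "equivalent_norms_on X N N'"
  shows "banach_sequence_space X N'"
proof -
  interpret A: banach_sequence_space X N by fact
  interpret B: normed_sequence_space X N' by fact
  obtain c C where c: "c > 0" "C > 0"
    and le: "\<And>x. x \<in> X \<Longrightarrow> c * N x \<le> N' x" "\<And>x. x \<in> X \<Longrightarrow> N' x \<le> C * N x"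
    using eqv unfolding equivalent_norms_on_def by blast
  show ?thesis
  proof
    fix u :: "nat \<Rightarrow> nat \<Rightarrow> 'a" assume u: "\<And>k. u k \<in> X"
      and cau: "\<And>e. 0 < e \<Longrightarrow> \<exists>K. \<forall>j\<ge>K. \<forall>k\<ge>K. N' (\<lambda>n. u j n - u k n) < e"
    have "\<exists>K. \<forall>j\<ge>K. \<forall>k\<ge>K. N (\<lambda>n. u j n - u k n) < e" if "0 < e" for e
    proof -
      from cau[OF mult_pos_pos[OF c(1) that]]
      obtain K where K: "\<forall>j\<ge>K. \<forall>k\<ge>K. N' (\<lambda>n. u j n - u k n) < c * e" by blast
      have "N (\<lambda>n. u j n - u k n) < e" if "j \<ge> K" "k \<ge> K" for j k
      proof -
        have "c * N (\<lambda>n. u j n - u k n) < c * e"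
          using K that le(1)[OF A.diff_mem[OF u u]] by (meson le_less_trans)
        then show ?thesis using c by simp
      qed
      then show ?thesis by blast
    qed
    from A.complete[of u, OF u this]
    obtain x where x: "x \<in> X" "(\<lambda>k. N (\<lambda>n. u k n - x n)) \<longlonglongrightarrow> 0" by blast
    have "(\<lambda>k. C * N (\<lambda>n. u k n - x n)) \<longlonglongrightarrow> 0"
      using tendsto_mult_left[OF x(2), of C] by simp
    then have "(\<lambda>k. N' (\<lambda>n. u k n - x n)) \<longlonglongrightarrow> 0"
      by (rule tendsto_sandwich[rotated 3, where f = "\<lambda>_. 0"])
         (use le A.diff_mem u x B.nrm_nonneg in auto)
    then show "\<exists>x\<in>X. (\<lambda>k. N' (\<lambda>n. u k n - x n)) \<longlonglongrightarrow> 0" using x by blast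
  qed
qed

context koethe_sequence_space
begin

lemma unit_seq_mem: "unit_seq k \<in> X"
  by (rule finite_support_mem) (simp add: if_distrib)

lemma nrm_unit_seq_pos: "nrm (unit_seq k) > 0"
proof -
  have "unit_seq k \<noteq> (\<lambda>n. 0 :: 'a)" by (auto dest: fun_cong[of _ _ k])
  then show ?thesis
    using nrm_eq_0_iff[OF unit_seq_mem, of k] nrm_nonneg[OF unit_seq_mem, of k] by linarith
qed

lemma nrm_cong_norm: "x \<in> X \<Longrightarrow> (\<And>n. norm (y n) = norm (x n)) \<Longrightarrow> nrm y = nrm x"
  by (rule antisym) (auto intro!: nrm_mono intro: solid_mem)

lemma norm_coordinate_le: "x \<in> X \<Longrightarrow> norm (x k) * nrm (unit_seq k) \<le> nrm x"
proof -
  assume x: "x \<in> X"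
  have "norm (x k) * nrm (unit_seq k) = nrm (\<lambda>n. x k * unit_seq k n)"
    using nrm_scale[OF unit_seq_mem] by simp
  also have "\<dots> \<le> nrm x" by (rule nrm_mono[OF x]) auto
  finally show ?thesis .
qed

lemma coordinate_tendsto:
  assumes "\<And>k. u k \<in> X" "x \<in> X" "(\<lambda>k. nrm (\<lambda>n. u k n - x n)) \<longlonglongrightarrow> 0"
  shows "(\<lambda>k. u k n) \<longlonglongrightarrow> x n"
proof -
  let ?e = "nrm (unit_seq n)"
  have "(\<lambda>k. nrm (\<lambda>n. u k n - x n) / ?e) \<longlonglongrightarrow> 0"
    using tendsto_divide[OF assms(3) tendsto_const, of ?e] nrm_unit_seq_pos[of n] by simp
  moreover have "norm (u k n - x n) \<le> nrm (\<lambda>n. u k n - x n) / ?e" for k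
    using norm_coordinate_le[OF diff_mem[OF assms(1,2)], of k n] nrm_unit_seq_pos[of n]
    by (simp add: pos_le_divide_eq)
  ultimately have "(\<lambda>k. u k n - x n) \<longlonglongrightarrow> 0"
    by (intro Lim_null_comparison[of "\<lambda>k. u k n - x n"]) auto
  then show ?thesis by (simp add: LIM_zero_iff)
qed

text \<open>The form in which completeness of the domain enters the gliding hump argument: the
  majorant is the sum of the series of the sequences \<open>|f k| / 2 ^ k\<close>.\<close>

lemma common_majorant:
  assumes f: "\<And>k. f k \<in> X" and f1: "\<And>k. nrm (f k) \<le> 1"
  shows "\<exists>F\<in>X. \<forall>k n. norm (f k n) \<le> 2 ^ k * norm (F n)"
proof -
  define r where "r m n = (\<Sum>k<m. norm (f k n) / 2 ^ k)" for m n
  define u where "u m n = (of_real (r m n) :: 'a)" for m n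
  define w where "w k n = (of_real (norm (f k n) / 2 ^ k) :: 'a)" for k n
  have w: "w k \<in> X" and w1: "nrm (w k) \<le> 1 / 2 ^ k" for k
  proof -
    have s: "(\<lambda>n. of_real (1 / 2 ^ k) * f k n) \<in> X" using scale_mem f by blast
    have e: "norm (w k n) = norm (of_real (1 / 2 ^ k) * f k n)" for n
      unfolding w_def norm_mult norm_of_real by simp
    show "w k \<in> X" by (rule solid_mem[OF s]) (simp only: e)
    have "nrm (w k) = norm (of_real (1 / 2 ^ k) :: 'a) * nrm (f k)"
      by (simp only: nrm_cong_norm[OF s e] nrm_scale[OF f])
    then show "nrm (w k) \<le> 1 / 2 ^ k"
      using f1[of k] unfolding norm_of_real by (simp add: divide_simps)
  qed
  have u_Suc: "u (Suc m) = (\<lambda>n. u m n + w m n)" for m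
    by (auto simp: u_def w_def r_def)
  have u: "u m \<in> X" for m
    by (induction m) (use zero_mem add_mem w in \<open>auto simp: u_Suc u_def[of 0] r_def\<close>)
  have step: "nrm (\<lambda>n. u (j + d) n - u j n) \<le> 2 / 2 ^ j - 2 / 2 ^ (j + d)" for j d
  proof (induction d)
    case 0 then show ?case by (simp add: nrm_zero)
  next
    case (Suc d)
    have "nrm (\<lambda>n. u (j + Suc d) n - u j n) = nrm (\<lambda>n. (u (j + d) n - u j n) + w (j + d) n)"
      by (simp add: u_Suc algebra_simps)
    also have "\<dots> \<le> nrm (\<lambda>n. u (j + d) n - u j n) + nrm (w (j + d))"
      by (rule nrm_triangle[OF diff_mem[OF u u] w])
    also have "\<dots> \<le> (2 / 2 ^ j - 2 / 2 ^ (j + d)) + 1 / 2 ^ (j + d)"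
      using Suc w1 by (intro add_mono)
    also have "\<dots> = 2 / 2 ^ j - 2 / 2 ^ (j + Suc d)" by (simp add: field_simps)
    finally show ?case .
  qed
  have cau: "nrm (\<lambda>n. u i n - u j n) \<le> 2 / 2 ^ K" if ij: "i \<ge> K" "j \<ge> K" for i j K
  proof -
    have *: "nrm (\<lambda>n. u i n - u j n) \<le> 2 / 2 ^ K" if "j \<ge> K" "i \<ge> j" for i j
    proof -
      have "nrm (\<lambda>n. u i n - u j n) \<le> 2 / 2 ^ j - 2 / 2 ^ i"
        using step[of j "i - j"] that by simp
      also have "\<dots> \<le> 2 / 2 ^ j" by simp
      also have "\<dots> \<le> 2 / 2 ^ K" using that by (intro divide_left_mono power_increasing) auto
      finally show ?thesis .
    qed
    have sym: "nrm (\<lambda>n. u i n - u j n) = nrm (\<lambda>n. u j n - u i n)"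
      by (rule nrm_cong_norm[OF diff_mem[OF u u]]) (rule norm_minus_commute)
    show ?thesis
    proof (cases "i \<ge> j")
      case True then show ?thesis using * ij by blast
    next
      case False then show ?thesis using *[of i j] sym ij by simp
    qed
  qed
  have "\<exists>K. \<forall>j\<ge>K. \<forall>k\<ge>K. nrm (\<lambda>n. u j n - u k n) < e" if "0 < e" for e
  proof -
    have "(1 / 2 :: real) < 1" by simp
    from real_arch_pow_inv[OF half_gt_zero[OF that] this]
    obtain K where "(1 / 2) ^ K < e / 2" by blast
    then have "2 / 2 ^ K < e" by (simp add: power_divide field_simps)
    then show ?thesis using cau by (meson le_less_trans)
  qed
  from complete[of u, OF u this]
  obtain F where F: "F \<in> X" "(\<lambda>k. nrm (\<lambda>n. u k n - F n)) \<longlonglongrightarrow> 0" by blast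
  have "norm (f k n) \<le> 2 ^ k * norm (F n)" for k n
  proof -
    have lim: "(\<lambda>m. norm (u m n)) \<longlonglongrightarrow> norm (F n)"
      by (intro tendsto_norm coordinate_tendsto u F)
    have "norm (f k n) / 2 ^ k \<le> norm (u m n)" if "m \<ge> Suc k" for m
    proof -
      have "norm (f k n) / 2 ^ k \<le> r m n"
        unfolding r_def by (rule member_le_sum) (use that in auto)
      also have "\<dots> \<le> norm (u m n)" unfolding u_def norm_of_real by simp
      finally show ?thesis .
    qed
    then have "norm (f k n) / 2 ^ k \<le> norm (F n)"
      by (intro LIMSEQ_le_const[OF lim]) blast
    then show ?thesis by (simp add: field_simps)
  qed
  then show ?thesis using F by blast
qed

end

section \<open>The multiplier space is a Koethe sequence space\<close>

locale koethe_pair =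
  X: koethe_sequence_space X nX + Y: koethe_sequence_space Y nY
  for X Y :: "(nat \<Rightarrow> 'a :: {real_normed_field, banach}) set" and nX nY
begin

abbreviation "M \<equiv> multipliers X Y"
abbreviation "nM \<equiv> multiplier_norm X nX nY"

lemma multiplierI: "(\<And>f. f \<in> X \<Longrightarrow> (\<lambda>n. f n * g n) \<in> Y) \<Longrightarrow> g \<in> M"
  and multiplierD: "g \<in> M \<Longrightarrow> f \<in> X \<Longrightarrow> (\<lambda>n. f n * g n) \<in> Y"
  by (auto simp: multipliers_def)

text \<open>Gliding hump: otherwise the majorant of elements \<open>f k\<close> of the unit ball with \<open>\<parallel>f k * g\<parallel> > 4 ^ k\<close> is mapped
  to an element of \<open>Y\<close> whose norm exceeds every \<open>2 ^ k\<close>.\<close>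

lemma multiplier_bounded:
  assumes g: "g \<in> M"
  shows "\<exists>C. \<forall>f\<in>X. nX f \<le> 1 \<longrightarrow> nY (\<lambda>n. f n * g n) \<le> C"
proof (rule ccontr)
  assume "\<not> ?thesis"
  then have "\<forall>k::nat. \<exists>f\<in>X. nX f \<le> 1 \<and> nY (\<lambda>n. f n * g n) > 4 ^ k"
    by (meson not_le)
  then obtain f where f: "\<And>k::nat. f k \<in> X" "\<And>k. nX (f k) \<le> 1"
    "\<And>k. nY (\<lambda>n. f k n * g n) > 4 ^ k" by metis
  obtain F where F: "F \<in> X" "\<And>k n. norm (f k n) \<le> 2 ^ k * norm (F n)"
    using X.common_majorant[of f] f(1,2) by blast
  have "2 ^ k < nY (\<lambda>n. F n * g n)" for k :: nat
  proof -
    note Fg = multiplierD[OF g F(1)]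
    have "(2 ^ k * 2 ^ k :: real) = 4 ^ k" by (simp flip: power_mult_distrib)
    also have "\<dots> < nY (\<lambda>n. f k n * g n)" by (rule f)
    also have "\<dots> \<le> nY (\<lambda>n. of_real (2 ^ k) * (F n * g n))"
    proof (rule Y.nrm_mono[OF Y.scale_mem[OF Fg]])
      show "norm (f k n * g n) \<le> norm (of_real (2 ^ k) * (F n * g n))" for n
        using mult_right_mono[OF F(2)[of k n], of "norm (g n)"]
        unfolding norm_mult norm_of_real by (simp add: mult.assoc)
    qed
    also have "\<dots> = 2 ^ k * nY (\<lambda>n. F n * g n)"
      by (subst Y.nrm_scale[OF Fg]) (simp only: norm_of_real, simp)
    finally show ?thesis by simp
  qed
  then show False using real_arch_pow[of 2 "nY (\<lambda>n. F n * g n)"] by (force dest: less_asym)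
qed

lemma multiplier_norm_upper:
  assumes "g \<in> M" "f \<in> X" "nX f \<le> 1"
  shows "nY (\<lambda>n. f n * g n) \<le> nM g"
  unfolding multiplier_norm_def
  by (rule cSUP_upper) (use assms multiplier_bounded[OF assms(1)] in \<open>auto simp: bdd_above_def\<close>)

lemma multiplier_norm_least:
  assumes "\<And>f. f \<in> X \<Longrightarrow> nX f \<le> 1 \<Longrightarrow> nY (\<lambda>n. f n * g n) \<le> C"
  shows "nM g \<le> C"
  unfolding multiplier_norm_def
proof (rule cSUP_least)
  show "{f \<in> X. nX f \<le> 1} \<noteq> {}" using X.zero_mem X.nrm_zero by force
qed (use assms in auto)

lemma multiplier_norm_nonneg: "g \<in> M \<Longrightarrow> 0 \<le> nM g"
  using multiplier_norm_upper[OF _ X.zero_mem] by (simp add: X.nrm_zero Y.nrm_zero)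

lemma multiplier_norm_mult:
  assumes g: "g \<in> M" and f: "f \<in> X"
  shows "nY (\<lambda>n. f n * g n) \<le> nX f * nM g"
proof (cases "nX f = 0")
  case True
  then have "f = (\<lambda>n. 0)" using X.nrm_eq_0_iff f by blast
  then show ?thesis using True by (simp add: Y.nrm_zero)
next
  case False
  define a where "a = nX f"
  have a: "a > 0" using False X.nrm_nonneg[OF f] by (simp add: a_def)
  let ?f = "\<lambda>n. of_real (1 / a) * f n"
  have "nX ?f = norm (of_real (1 / a) :: 'a) * a" by (simp only: X.nrm_scale[OF f] a_def)
  then have "nX ?f \<le> 1" using a unfolding norm_of_real by simp
  then have "nY (\<lambda>n. ?f n * g n) \<le> nM g"
    by (rule multiplier_norm_upper[OF g X.scale_mem[OF f]])
  moreover have "nY (\<lambda>n. ?f n * g n) = norm (of_real (1 / a) :: 'a) * nY (\<lambda>n. f n * g n)"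
    by (simp only: mult.assoc Y.nrm_scale[OF multiplierD[OF g f]])
  ultimately have "nY (\<lambda>n. f n * g n) / a \<le> nM g" using a unfolding norm_of_real by simp
  then show ?thesis using a by (simp add: a_def field_simps)
qed

lemma norm_multiplier_coordinate_le:
  assumes g: "g \<in> M"
  shows "norm (g k) * nY (unit_seq k) \<le> nX (unit_seq k) * nM g"
proof -
  have "norm (g k) * nY (unit_seq k) = nY (\<lambda>n. unit_seq k n * g n)"
    by (subst Y.nrm_scale[OF Y.unit_seq_mem, symmetric]) (rule arg_cong[of _ _ nY], auto)
  also have "\<dots> \<le> nX (unit_seq k) * nM g" by (rule multiplier_norm_mult[OF g X.unit_seq_mem])
  finally show ?thesis .
qed

lemma multiplier_solid:
  assumes h: "h \<in> M" and le: "\<And>n. norm (g n) \<le> norm (h n)"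
  shows "g \<in> M" "nM g \<le> nM h"
proof -
  have *: "norm (f n * g n) \<le> norm (f n * h n)" for f n
    using le by (simp add: norm_mult mult_left_mono)
  show "g \<in> M" using Y.solid_mem[OF multiplierD[OF h] *] by (intro multiplierI)
  show "nM g \<le> nM h"
    by (rule multiplier_norm_least)
       (rule order_trans[OF Y.nrm_mono[OF multiplierD[OF h] *] multiplier_norm_upper[OF h]])
qed

lemma multiplier_scale: "g \<in> M \<Longrightarrow> (\<lambda>n. c * g n) \<in> M"
  using Y.scale_mem[OF multiplierD, of g _ c] by (intro multiplierI) (simp add: ac_simps)

lemma multiplier_norm_scale_le: "g \<in> M \<Longrightarrow> nM (\<lambda>n. c * g n) \<le> norm c * nM g"
proof (rule multiplier_norm_least)
  fix f assume g: "g \<in> M" and f: "f \<in> X" "nX f \<le> 1"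
  have "nY (\<lambda>n. f n * (c * g n)) = norm c * nY (\<lambda>n. f n * g n)"
    using Y.nrm_scale[OF multiplierD[OF g f(1)], of c] by (simp add: ac_simps)
  then show "nY (\<lambda>n. f n * (c * g n)) \<le> norm c * nM g"
    using multiplier_norm_upper[OF g f] by (simp add: mult_left_mono)
qed

lemma normed_multipliers: "normed_sequence_space M nM"
proof
  show "(\<lambda>n. 0) \<in> M" by (simp add: multipliers_def Y.zero_mem)
next
  fix g h assume g: "g \<in> M" and h: "h \<in> M"
  show "(\<lambda>n. g n + h n) \<in> M"
    using Y.add_mem[OF multiplierD[OF g] multiplierD[OF h]]
    by (intro multiplierI) (simp add: distrib_left)
  show "nM (\<lambda>n. g n + h n) \<le> nM g + nM h"
  proof (rule multiplier_norm_least)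
    fix f assume f: "f \<in> X" "nX f \<le> 1"
    have "nY (\<lambda>n. f n * (g n + h n)) \<le> nY (\<lambda>n. f n * g n) + nY (\<lambda>n. f n * h n)"
      using Y.nrm_triangle[OF multiplierD[OF g f(1)] multiplierD[OF h f(1)]]
      by (simp add: distrib_left)
    also have "\<dots> \<le> nM g + nM h" by (intro add_mono multiplier_norm_upper g h f)
    finally show "nY (\<lambda>n. f n * (g n + h n)) \<le> nM g + nM h" .
  qed
next
  fix c g assume g: "g \<in> M"
  show "(\<lambda>n. c * g n) \<in> M" by (rule multiplier_scale[OF g])
  show "0 \<le> nM g" by (rule multiplier_norm_nonneg[OF g])
  show "nM g = 0 \<longleftrightarrow> g = (\<lambda>n. 0)"
  proof
    assume "nM g = 0"
    then have "norm (g k) * nY (unit_seq k) \<le> 0" for k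
      using norm_multiplier_coordinate_le[OF g, of k] by simp
    then have "norm (g k) \<le> 0" for k
      using Y.nrm_unit_seq_pos[of k] by (metis mult_le_0_iff not_le)
    then show "g = (\<lambda>n. 0)" by auto
  next
    assume [simp]: "g = (\<lambda>n. 0)"
    have "nM g \<le> 0" by (rule multiplier_norm_least) (simp add: Y.nrm_zero)
    then show "nM g = 0" using multiplier_norm_nonneg[OF g] by linarith
  qed
  have "norm c * nM g \<le> nM (\<lambda>n. c * g n)"
  proof (cases "c = 0")
    case True
    then show ?thesis using multiplier_norm_nonneg[OF multiplier_scale[OF g, of c]] by simp
  next
    case False
    \<comment> \<open>the upper estimate for the scalar \<open>inverse c\<close>\<close>
    have "nM g \<le> norm (inverse c) * nM (\<lambda>n. c * g n)"
      using multiplier_norm_scale_le[OF multiplier_scale[OF g, of c], of "inverse c"] False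
      by (simp flip: mult.assoc)
    then show ?thesis using False by (simp add: norm_inverse norm_divide field_simps)
  qed
  then show "nM (\<lambda>n. c * g n) = norm c * nM g"
    using multiplier_norm_scale_le[OF g] by (rule antisym[rotated])
qed

text \<open>A Cauchy sequence of multipliers converges coordinatewise. For each \<open>f\<close> in \<open>X\<close> the products
  with \<open>f\<close> converge in \<open>Y\<close>, necessarily to the product with the coordinatewise limit, and the Cauchy
  estimate, being uniform over the unit ball of \<open>X\<close>, passes to this limit.\<close>

lemma banach_multipliers: "banach_sequence_space M nM"
proof -
  interpret normed_sequence_space M nM by (rule normed_multipliers)
  show ?thesis
  proof
    fix u :: "nat \<Rightarrow> nat \<Rightarrow> 'a" assume u: "\<And>k. u k \<in> M"
      and cau: "\<And>e. 0 < e \<Longrightarrow> \<exists>K. \<forall>j\<ge>K. \<forall>k\<ge>K. nM (\<lambda>n. u j n - u k n) < e"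
    have prod: "\<exists>y\<in>Y. (\<lambda>k. nY (\<lambda>n. f n * u k n - y n)) \<longlonglongrightarrow> 0" if f: "f \<in> X" for f
    proof (rule Y.complete)
      show "(\<lambda>n. f n * u k n) \<in> Y" for k using u f multiplierD by blast
      fix e :: real assume e: "0 < e"
      define a where "a = nX f + 1"
      have a: "a > 0" "nX f \<le> a" using X.nrm_nonneg[OF f] by (auto simp: a_def)
      obtain K where K: "\<And>j k. j \<ge> K \<Longrightarrow> k \<ge> K \<Longrightarrow> nM (\<lambda>n. u j n - u k n) < e / a"
        using cau[of "e / a"] e a by auto
      have "nY (\<lambda>n. f n * u j n - f n * u k n) < e" if jk: "j \<ge> K" "k \<ge> K" for j k
      proof -
        have d: "(\<lambda>n. u j n - u k n) \<in> M" using diff_mem u by blast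
        have "nY (\<lambda>n. f n * u j n - f n * u k n) \<le> nX f * nM (\<lambda>n. u j n - u k n)"
          using multiplier_norm_mult[OF d f] by (simp add: right_diff_distrib)
        also have "\<dots> \<le> a * nM (\<lambda>n. u j n - u k n)"
          using a nrm_nonneg[OF d] by (intro mult_right_mono)
        also have "\<dots> < e" using K[OF jk] a by (simp add: field_simps)
        finally show ?thesis .
      qed
      then show "\<exists>K. \<forall>j\<ge>K. \<forall>k\<ge>K. nY (\<lambda>n. f n * u j n - f n * u k n) < e" by blast
    qed
    \<comment> \<open>the coordinates of the limit are read off by testing on the unit vectors\<close>
    have "\<exists>l. (\<lambda>k. u k i) \<longlonglongrightarrow> l" for i
    proof -
      obtain y where "y \<in> Y" "(\<lambda>k. nY (\<lambda>n. unit_seq i n * u k n - y n)) \<longlonglongrightarrow> 0"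
        using prod[OF X.unit_seq_mem] by blast
      then have "(\<lambda>k. unit_seq i i * u k i) \<longlonglongrightarrow> y i"
        using Y.coordinate_tendsto[of "\<lambda>k n. unit_seq i n * u k n" y i]
          multiplierD[OF u X.unit_seq_mem] by blast
      then show ?thesis by auto
    qed
    then obtain g where g: "\<And>i. (\<lambda>k. u k i) \<longlonglongrightarrow> g i" by metis
    have conv: "(\<lambda>n. f n * g n) \<in> Y \<and> (\<lambda>k. nY (\<lambda>n. f n * u k n - f n * g n)) \<longlonglongrightarrow> 0"
      if f: "f \<in> X" for f
    proof -
      obtain y where y: "y \<in> Y" "(\<lambda>k. nY (\<lambda>n. f n * u k n - y n)) \<longlonglongrightarrow> 0"
        using prod[OF f] by blast
      have "y i = f i * g i" for i
      proof (rule LIMSEQ_unique)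
        show "(\<lambda>k. f i * u k i) \<longlonglongrightarrow> y i"
          using Y.coordinate_tendsto[of "\<lambda>k n. f n * u k n" y i] multiplierD[OF u f] y by blast
        show "(\<lambda>k. f i * u k i) \<longlonglongrightarrow> f i * g i" by (intro tendsto_intros g)
      qed
      then have "y = (\<lambda>n. f n * g n)" by auto
      then show ?thesis using y by simp
    qed
    have gM: "g \<in> M" using conv by (intro multiplierI) blast
    have "(\<lambda>k. nM (\<lambda>n. u k n - g n)) \<longlonglongrightarrow> 0"
    proof (rule LIMSEQ_I)
      fix e :: real assume e: "0 < e"
      obtain K where K: "\<And>j k. j \<ge> K \<Longrightarrow> k \<ge> K \<Longrightarrow> nM (\<lambda>n. u j n - u k n) < e / 2"
        using cau[of "e / 2"] e by auto
      have "norm (nM (\<lambda>n. u k n - g n) - 0) < e" if k: "k \<ge> K" for k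
      proof -
        have "nM (\<lambda>n. u k n - g n) \<le> e / 2"
        proof (rule multiplier_norm_least)
          fix f assume f: "f \<in> X" "nX f \<le> 1"
          have "nY (\<lambda>n. f n * (u k n - g n))
              \<le> e / 2 + nY (\<lambda>n. f n * u j n - f n * g n)" if j: "j \<ge> K" for j
          proof -
            have m: "(\<lambda>n. u k n - u j n) \<in> M" "(\<lambda>n. u j n - g n) \<in> M"
              using diff_mem u gM by blast+
            have "nY (\<lambda>n. f n * (u k n - g n))
                = nY (\<lambda>n. f n * (u k n - u j n) + f n * (u j n - g n))"
              by (simp flip: distrib_left)
            also have "\<dots> \<le> nY (\<lambda>n. f n * (u k n - u j n)) + nY (\<lambda>n. f n * (u j n - g n))"
              by (rule Y.nrm_triangle[OF multiplierD[OF m(1) f(1)] multiplierD[OF m(2) f(1)]])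
            also have "\<dots> \<le> e / 2 + nY (\<lambda>n. f n * u j n - f n * g n)"
              using multiplier_norm_upper[OF m(1) f] K[OF k j] by (simp add: right_diff_distrib)
            finally show ?thesis .
          qed
          moreover have "(\<lambda>j. e / 2 + nY (\<lambda>n. f n * u j n - f n * g n)) \<longlonglongrightarrow> e / 2 + 0"
            using conv[OF f(1)] by (intro tendsto_intros) blast
          ultimately show "nY (\<lambda>n. f n * (u k n - g n)) \<le> e / 2"
            using LIMSEQ_le_const[of "\<lambda>j. e / 2 + nY (\<lambda>n. f n * u j n - f n * g n)" "e / 2"]
            by auto
        qed
        then show ?thesis using nrm_nonneg[OF diff_mem[OF u gM], of k] e by simp
      qed
      then show "\<exists>K. \<forall>k\<ge>K. norm (nM (\<lambda>n. u k n - g n) - 0) < e" by blast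
    qed
    then show "\<exists>x\<in>M. (\<lambda>k. nM (\<lambda>n. u k n - x n)) \<longlonglongrightarrow> 0" using gM by blast
  qed
qed

lemma koethe_multipliers: "koethe_sequence_space M nM"
proof -
  interpret banach_sequence_space M nM by (rule banach_multipliers)
  show ?thesis
  proof
    fix x :: "nat \<Rightarrow> 'a" assume "finite {n. x n \<noteq> 0}"
    then have "finite {n. f n * x n \<noteq> 0}" for f by (rule finite_subset[rotated]) auto
    then show "x \<in> M" by (intro multiplierI Y.finite_support_mem)
  qed (use multiplier_solid in blast)+
qed

end

section \<open>Transplantation and equimeasurability\<close>

lemma emeasure_count_space_inj_image:
  assumes "inj_on \<tau> A"
  shows "emeasure (count_space UNIV) (\<tau> ` A) = emeasure (count_space UNIV) A"
  using assms by (simp add: emeasure_count_space card_image finite_image_iff)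

lemma equimeasurable_sym: "equimeasurable x y \<Longrightarrow> equimeasurable y x"
  by (simp add: equimeasurable_def)

lemma equimeasurable_level_sets:
  assumes "equimeasurable x y" "t \<ge> 0"
  shows "finite {n. t < norm (x n)} \<longleftrightarrow> finite {n. t < norm (y n)}"
    and "card {n. t < norm (x n)} = card {n. t < norm (y n)}"
proof -
  have "emeasure (count_space UNIV) {n. t < norm (x n)}
      = emeasure (count_space UNIV) {n. t < norm (y n)}"
    using assms by (simp add: equimeasurable_def distribution_function_def)
  then show "finite {n. t < norm (x n)} \<longleftrightarrow> finite {n. t < norm (y n)}"
    "card {n. t < norm (x n)} = card {n. t < norm (y n)}"
    by (auto simp: emeasure_count_space split: if_splits)
qed

lemma equimeasurable_transplant:
  assumes inj: "inj_on \<tau> S"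
    and x: "\<And>n. n \<notin> S \<Longrightarrow> x n = 0" and y: "\<And>n. n \<notin> \<tau> ` S \<Longrightarrow> y n = 0"
    and eq: "\<And>n. n \<in> S \<Longrightarrow> norm (y (\<tau> n)) = norm (x n)"
  shows "equimeasurable x y"
  unfolding equimeasurable_def distribution_function_def
proof (intro allI impI)
  fix t :: real assume t: "t \<ge> 0"
  have S: "{n. t < norm (x n)} \<subseteq> S" using x t by fastforce
  have "{n. t < norm (y n)} = \<tau> ` {n. t < norm (x n)}"
  proof safe
    fix n assume n: "t < norm (y n)"
    then have "n \<in> \<tau> ` S" using y[of n] t by fastforce
    then show "n \<in> \<tau> ` {n. t < norm (x n)}" using n eq by auto
  next
    fix n assume "t < norm (x n)"
    then show "t < norm (y (\<tau> n))" using S eq by auto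
  qed
  then show "emeasure (count_space UNIV) {n. t < norm (x n)}
      = emeasure (count_space UNIV) {n. t < norm (y n)}"
    using emeasure_count_space_inj_image[OF inj_on_subset[OF inj S]] by simp
qed

text \<open>For positive \<open>v\<close>, the level set of \<open>|x|\<close> at \<open>v\<close> is \<open>{|x| > s} - {|x| > v}\<close> for every \<open>s < v\<close> close
  enough to \<open>v\<close>, and likewise for \<open>y\<close>. Since \<open>|x|\<close> and \<open>|y|\<close> take only finitely many values above
  \<open>v/2\<close>, the largest of these below \<open>v\<close> (or \<open>v/2\<close>, if there are none) can be chosen as \<open>s\<close> for both.\<close>

lemma equimeasurable_card_level:
  assumes eqm: "equimeasurable x y" and v: "v > 0"
    and finx: "\<And>t. t > 0 \<Longrightarrow> finite {n. t < norm (x n)}"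
    and finy: "\<And>t. t > 0 \<Longrightarrow> finite {n. t < norm (y n)}"
  shows "card {n. norm (x n) = v} = card {n. norm (y n) = v}"
proof -
  have card_eq: "card {n. t < norm (x n)} = card {n. t < norm (y n)}" if t: "t > 0" for t
    using equimeasurable_level_sets(2)[OF eqm] t by simp
  define B where "B = insert (v / 2) {w \<in> (\<lambda>n. norm (x n)) ` {n. v / 2 < norm (x n)}
      \<union> (\<lambda>n. norm (y n)) ` {n. v / 2 < norm (y n)}. w < v}"
  have B: "finite B" "B \<noteq> {}"
    using finx[of "v / 2"] finy[of "v / 2"] v by (auto simp: B_def)
  define s where "s = Max B"
  have "s \<in> B" using B by (simp add: s_def)
  moreover have s2: "v / 2 \<le> s" unfolding s_def by (rule Max_ge[OF B(1)]) (simp add: B_def)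
  ultimately have s: "s > 0" "s < v" using v by (auto simp: B_def)
  have gap_x: "\<not> (s < norm (x n) \<and> norm (x n) < v)" for n
  proof
    assume n: "s < norm (x n) \<and> norm (x n) < v"
    then have "norm (x n) \<in> B" using s2 by (auto simp: B_def)
    from Max_ge[OF B(1) this] show False using n by (simp add: s_def)
  qed
  have gap_y: "\<not> (s < norm (y n) \<and> norm (y n) < v)" for n
  proof
    assume n: "s < norm (y n) \<and> norm (y n) < v"
    then have "norm (y n) \<in> B" using s2 by (auto simp: B_def)
    from Max_ge[OF B(1) this] show False using n by (simp add: s_def)
  qed
  have "{n. norm (x n) = v} = {n. s < norm (x n)} - {n. v < norm (x n)}"
    using s gap_x by (auto simp: not_less) (meson antisym not_le)+
  then have "card {n. norm (x n) = v} = card {n. s < norm (x n)} - card {n. v < norm (x n)}"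
    using s v finx by (auto intro!: card_Diff_subset)
  moreover have "{n. norm (y n) = v} = {n. s < norm (y n)} - {n. v < norm (y n)}"
    using s gap_y by (auto simp: not_less) (meson antisym not_le)+
  then have "card {n. norm (y n) = v} = card {n. s < norm (y n)} - card {n. v < norm (y n)}"
    using s v finy by (auto intro!: card_Diff_subset)
  ultimately show ?thesis using card_eq s v by simp
qed

text \<open>The injection is glued from bijections between the level sets of \<open>|x|\<close> and \<open>|y|\<close>.\<close>

lemma equimeasurable_imp_matching:
  assumes eqm: "equimeasurable x y"
    and finx: "\<And>t. t > 0 \<Longrightarrow> finite {n. t < norm (x n)}"
    and finy: "\<And>t. t > 0 \<Longrightarrow> finite {n. t < norm (y n)}"
  shows "\<exists>\<tau>. inj_on \<tau> {n. x n \<noteq> 0} \<and> (\<forall>n. x n \<noteq> 0 \<longrightarrow> norm (y (\<tau> n)) = norm (x n))"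
proof -
  have "\<exists>b. bij_betw b {n. norm (x n) = v} {n. norm (y n) = v}" if v: "v > 0" for v
  proof (rule finite_same_card_bij)
    show "finite {n. norm (x n) = v}" "finite {n. norm (y n) = v}"
      using v by (auto intro: finite_subset[OF _ finx[of "v / 2"]] finite_subset[OF _ finy[of "v / 2"]])
  qed (rule equimeasurable_card_level[OF eqm v finx finy])
  then obtain b where b: "\<And>v. v > 0 \<Longrightarrow>
      bij_betw (b v) {n. norm (x n) = v} {n. norm (y n) = v}" by metis
  define \<tau> where "\<tau> n = b (norm (x n)) n" for n
  have lev: "norm (y (\<tau> n)) = norm (x n)" if "x n \<noteq> 0" for n
    using b[of "norm (x n)"] that by (auto simp: \<tau>_def bij_betw_def)
  moreover have "inj_on \<tau> {n. x n \<noteq> 0}"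
  proof (rule inj_onI)
    fix m n assume mn: "m \<in> {n. x n \<noteq> 0}" "n \<in> {n. x n \<noteq> 0}" "\<tau> m = \<tau> n"
    then have e: "norm (x m) = norm (x n)" using lev[of m] lev[of n] by simp
    have "inj_on (b (norm (x n))) {k. norm (x k) = norm (x n)}"
      using b[of "norm (x n)"] mn by (auto simp: bij_betw_def)
    then show "m = n" using mn(3) e by (auto simp: \<tau>_def inj_on_def)
  qed
  ultimately show ?thesis by blast
qed

section \<open>Multipliers between rearrangement invariant spaces\<close>

context ri_sequence_space
begin

lemma nrm_unit_seq: "nrm (unit_seq k) = nrm (unit_seq 0)"
  by (rule equimeasurable_nrm[OF _ unit_seq_mem])
     (rule equimeasurable_transplant[of "\<lambda>_. 0" "{k}"], auto)

end

locale ri_pair =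
  X: ri_sequence_space X nX + Y: ri_sequence_space Y nY
  for X Y :: "(nat \<Rightarrow> 'a :: {real_normed_field, banach}) set" and nX nY
begin

sublocale koethe_pair X Y nX nY ..

lemma multiplier_transplant:
  assumes inj: "inj_on \<tau> S" and g: "\<And>n. n \<notin> S \<Longrightarrow> g n = 0"
    and le: "\<And>n. n \<in> S \<Longrightarrow> norm (g n) \<le> norm (h (\<tau> n))" and h: "h \<in> M"
  shows "g \<in> M" and "nM g \<le> nM h"
proof -
  define push where "push f n = (if n \<in> \<tau> ` S then f (inv_into S \<tau> n) else 0)"
    for f :: "nat \<Rightarrow> 'a" and n
  have push: "push f (\<tau> n) = f n" if "n \<in> S" for f n
    using that inj by (simp add: push_def)
  have push_off: "push f n = 0" if "n \<notin> \<tau> ` S" for f n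
    using that by (simp add: push_def)
  have *: "(\<lambda>n. f n * g n) \<in> Y \<and> nY (\<lambda>n. f n * g n) \<le> nM h" if f: "f \<in> X" "nX f \<le> 1" for f
  proof -
    let ?f = "\<lambda>n. if n \<in> S then f n else 0"
    have eqm: "equimeasurable (push f) ?f"
      by (rule equimeasurable_sym, rule equimeasurable_transplant[OF inj])
         (auto simp: push push_off)
    have "?f \<in> X" "nX ?f \<le> nX f"
      by (rule X.solid_mem[OF f(1)] X.nrm_mono[OF f(1)]; simp)+
    then have pf: "push f \<in> X" "nX (push f) \<le> 1"
      using X.equimeasurable_mem[OF eqm] X.equimeasurable_nrm[OF eqm] f by auto
    let ?p = "push (\<lambda>n. f n * g n)"
    have p_le: "norm (?p n) \<le> norm (push f n * h n)" for n
    proof (cases "n \<in> \<tau> ` S")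
      case True
      then show ?thesis using le by (auto simp: push norm_mult intro!: mult_left_mono)
    qed (simp add: push_off)
    note ph = multiplierD[OF h pf(1)]
    have p: "?p \<in> Y" "nY ?p \<le> nM h"
      using Y.solid_mem[OF ph p_le] Y.nrm_mono[OF ph p_le] multiplier_norm_upper[OF h pf]
      by auto
    have eqm': "equimeasurable (\<lambda>n. f n * g n) ?p"
      by (rule equimeasurable_transplant[OF inj]) (auto simp: g push push_off)
    show ?thesis using Y.equimeasurable_mem[OF eqm'] Y.equimeasurable_nrm[OF eqm'] p by simp
  qed
  show "nM g \<le> nM h" using * by (intro multiplier_norm_least) blast
  show "g \<in> M"
  proof (rule multiplierI)
    fix f assume f: "f \<in> X"
    \<comment> \<open>scaling \<open>f\<close> into the unit ball; adding 1 avoids a division by zero\<close>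
    define c where "c = 1 / (nX f + 1)"
    have c: "c > 0" "c * nX f \<le> 1" using X.nrm_nonneg[OF f] by (auto simp: c_def field_simps)
    have "nX (\<lambda>n. of_real c * f n) \<le> 1"
      using c by (subst X.nrm_scale[OF f]) (simp add: norm_of_real)
    then have "(\<lambda>n. of_real c * f n * g n) \<in> Y" using *[OF X.scale_mem[OF f]] by blast
    then have "(\<lambda>n. of_real (1 / c) * (of_real c * f n * g n)) \<in> Y" by (rule Y.scale_mem)
    then show "(\<lambda>n. f n * g n) \<in> Y" using c by simp
  qed
qed

lemma equimeasurable_multiplier:
  assumes eqm: "equimeasurable g h" and h: "h \<in> M"
    and fing: "\<And>t. t > 0 \<Longrightarrow> finite {n. t < norm (g n)}"
    and finh: "\<And>t. t > 0 \<Longrightarrow> finite {n. t < norm (h n)}"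
  shows "g \<in> M" and "nM g \<le> nM h"
proof -
  obtain \<tau> where \<tau>: "inj_on \<tau> {n. g n \<noteq> 0}" "\<And>n. g n \<noteq> 0 \<Longrightarrow> norm (h (\<tau> n)) = norm (g n)"
    using equimeasurable_imp_matching[OF eqm fing finh] by blast
  show "g \<in> M" "nM g \<le> nM h"
    by (rule multiplier_transplant[OF \<tau>(1) _ _ h]; use \<tau>(2) in simp)+
qed

lemma ri_multipliers_if_null:
  assumes fin: "\<And>g t. g \<in> M \<Longrightarrow> t > 0 \<Longrightarrow> finite {n. t < norm (g n)}"
  shows "ri_sequence_space M nM"
proof -
  interpret koethe_sequence_space M nM by (rule koethe_multipliers)
  show ?thesis
  proof
    fix g h :: "nat \<Rightarrow> 'a" assume eqm: "equimeasurable g h" and h: "h \<in> M"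
    have fing: "finite {n. t < norm (g n)}" if "t > 0" for t
      using equimeasurable_level_sets(1)[OF eqm] fin[OF h that] that by simp
    show g: "g \<in> M" using equimeasurable_multiplier[OF eqm h fing fin[OF h]] by blast
    show "nM g = nM h"
      using equimeasurable_multiplier(2)[OF eqm h fing fin[OF h]]
        equimeasurable_multiplier(2)[OF equimeasurable_sym[OF eqm] g fin[OF h] fing]
      by (rule antisym)
  qed
qed

lemma one_multiplier:
  assumes h: "h \<in> M" and t: "t > 0" and inf: "infinite {n. t < norm (h n)}"
  shows "(\<lambda>n. 1) \<in> M"
proof -
  let ?A = "{n. t < norm (h n)}"
  have "(\<lambda>n. of_real t) \<in> M"
  proof (rule multiplier_transplant(1)[OF _ _ _ h])
    show "inj (enumerate ?A)" using strict_mono_enumerate[OF inf] strict_mono_imp_inj_on by blast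
    show "norm (of_real t :: 'a) \<le> norm (h (enumerate ?A n))" for n
      using enumerate_in_set[OF inf, of n] t by (simp add: norm_of_real)
  qed auto
  from multiplier_scale[OF this, of "of_real (1 / t)"] show ?thesis using t by simp
qed

lemma norm_multiplier_le:
  assumes "g \<in> M"
  shows "norm (g k) \<le> nX (unit_seq 0) / nY (unit_seq 0) * nM g"
  using norm_multiplier_coordinate_le[OF assms, of k] Y.nrm_unit_seq_pos[of 0]
    X.nrm_unit_seq[of k] Y.nrm_unit_seq[of k] by (simp add: field_simps)

end

section \<open>The case of bounded sequences\<close>

definition sup_norm :: "(nat \<Rightarrow> 'a :: real_normed_vector) \<Rightarrow> real" where
  "sup_norm x = (SUP n. norm (x n))"

lemma norm_le_sup_norm: "(\<And>n. norm (x n) \<le> C) \<Longrightarrow> norm (x k) \<le> sup_norm x"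
  unfolding sup_norm_def by (rule cSUP_upper) (auto simp: bdd_above_def)

lemma sup_norm_le: "(\<And>n. norm (x n) \<le> C) \<Longrightarrow> sup_norm x \<le> C"
  unfolding sup_norm_def by (rule cSUP_least) auto

lemma equimeasurable_norm_le:
  assumes "equimeasurable x y" and y: "\<And>n. norm (y n) \<le> C"
  shows "norm (x k) \<le> C"
proof -
  have C: "0 \<le> C" using y[of 0] norm_ge_zero order_trans by blast
  have "{n. C < norm (y n)} = {}" using y by (auto simp: not_less)
  moreover have "emeasure (count_space UNIV) {n. C < norm (x n)}
      = emeasure (count_space UNIV) {n. C < norm (y n)}"
    using assms(1) C by (auto simp: equimeasurable_def distribution_function_def)
  ultimately have "{n. C < norm (x n)} = {}"
    by (simp add: emeasure_count_space_eq_0)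
  then show ?thesis by (auto simp: not_less)
qed

lemma normed_sup_norm:
  fixes V :: "(nat \<Rightarrow> 'a :: {real_normed_field, banach}) set"
  assumes V: "\<And>x. x \<in> V \<longleftrightarrow> (\<exists>C. \<forall>n. norm (x n) \<le> C)"
  shows "normed_sequence_space V sup_norm"
proof
  have up: "norm (x n) \<le> sup_norm x" if "x \<in> V" for x n
    using that norm_le_sup_norm unfolding V by blast
  show "(\<lambda>n. 0) \<in> V" unfolding V by auto
  fix x y :: "nat \<Rightarrow> 'a" and c assume x: "x \<in> V"
  show "0 \<le> sup_norm x" using up[OF x, of 0] norm_ge_zero order_trans by blast
  have 0: "sup_norm (\<lambda>n. 0 :: 'a) = 0" by (simp add: sup_norm_def)
  show "sup_norm x = 0 \<longleftrightarrow> x = (\<lambda>n. 0)" using up[OF x] 0 by force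
  have cx_le: "norm (c * x n) \<le> norm c * sup_norm x" for c n
    using up[OF x] by (simp add: norm_mult mult_left_mono)
  show cx: "(\<lambda>n. c * x n) \<in> V" using cx_le unfolding V by blast
  show "sup_norm (\<lambda>n. c * x n) = norm c * sup_norm x"
  proof (cases "c = 0")
    case True then show ?thesis by (simp add: 0)
  next
    case False
    have "norm (x n) \<le> sup_norm (\<lambda>n. c * x n) / norm c" for n
      using up[OF cx, of n] False by (simp add: norm_mult field_simps)
    then have "sup_norm x \<le> sup_norm (\<lambda>n. c * x n) / norm c" by (rule sup_norm_le)
    then show ?thesis using False sup_norm_le[of "\<lambda>n. c * x n", OF cx_le]
      by (intro antisym) (auto simp: field_simps)
  qed
  assume y: "y \<in> V"
  have "norm (x n + y n) \<le> sup_norm x + sup_norm y" for n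
    by (rule order_trans[OF norm_triangle_ineq add_mono[OF up[OF x] up[OF y]]])
  then show "(\<lambda>n. x n + y n) \<in> V" "sup_norm (\<lambda>n. x n + y n) \<le> sup_norm x + sup_norm y"
    using sup_norm_le[of "\<lambda>n. x n + y n"] unfolding V by blast+
qed

context ri_pair
begin

lemma multipliers_eq_bounded:
  assumes one: "(\<lambda>n. 1) \<in> M"
  shows "g \<in> M \<longleftrightarrow> (\<exists>C. \<forall>n. norm (g n) \<le> C)"
proof
  assume "\<exists>C. \<forall>n. norm (g n) \<le> C"
  then obtain C where C: "\<And>n. norm (g n) \<le> C" by blast
  then have "norm (g n) \<le> norm (of_real C * (1 :: 'a))" for n
    using order_trans[OF C abs_ge_self] by (simp add: norm_of_real)
  then show "g \<in> M" using multiplier_solid(1)[OF multiplier_scale[OF one, of "of_real C"]] by blast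
qed (use norm_multiplier_le in blast)

lemma ri_multipliers_sup_norm:
  assumes one: "(\<lambda>n. 1) \<in> M"
  shows "ri_sequence_space M sup_norm" and "equivalent_norms_on M nM sup_norm"
proof -
  note bdd = multipliers_eq_bounded[OF one]
  interpret A: koethe_sequence_space M nM by (rule koethe_multipliers)
  interpret B: normed_sequence_space M sup_norm by (rule normed_sup_norm[OF bdd])
  have up: "norm (x n) \<le> sup_norm x" if "x \<in> M" for x n
    using that norm_le_sup_norm unfolding bdd by blast
  define K where "K = nX (unit_seq 0) / nY (unit_seq 0)"
  have K: "K > 0" using X.nrm_unit_seq_pos[of 0] Y.nrm_unit_seq_pos[of 0] by (simp add: K_def)
  \<comment> \<open>any number above the norm of the constant 1 that is certainly positive\<close>
  define L where "L = nM (\<lambda>n. 1) + 1"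
  have L: "L > 0" using multiplier_norm_nonneg[OF one] by (simp add: L_def)
  have le1: "sup_norm g \<le> K * nM g" if "g \<in> M" for g
    using norm_multiplier_le[OF that] unfolding K_def by (rule sup_norm_le)
  have le2: "nM g \<le> L * sup_norm g" if g: "g \<in> M" for g
  proof -
    let ?c = "of_real (sup_norm g) :: 'a"
    have nn: "0 \<le> sup_norm g" by (rule B.nrm_nonneg[OF g])
    have "nM g \<le> nM (\<lambda>n. ?c * 1)"
      by (rule multiplier_solid(2)[OF multiplier_scale[OF one]]) (use up[OF g] nn in simp)
    also have "\<dots> \<le> sup_norm g * nM (\<lambda>n. 1)"
      using multiplier_norm_scale_le[OF one, of ?c] nn by simp
    also have "\<dots> \<le> L * sup_norm g" using nn by (simp add: L_def algebra_simps)
    finally show ?thesis .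
  qed
  have "1 / L * nM g \<le> sup_norm g" if "g \<in> M" for g
    using le2[OF that] L by (simp add: field_simps)
  then show eqv: "equivalent_norms_on M nM sup_norm"
    unfolding equivalent_norms_on_def using K L le1
    by (intro exI[of _ "1 / L"] exI[of _ K] conjI) auto
  interpret B: banach_sequence_space M sup_norm
    by (rule banach_sequence_space_equivalent_norm[OF banach_multipliers normed_sup_norm[OF bdd] eqv])
  have eq_le: "sup_norm x \<le> sup_norm y" if "equimeasurable x y" "y \<in> M" for x y
    using equimeasurable_norm_le[OF that(1) up[OF that(2)]] by (rule sup_norm_le)
  show "ri_sequence_space M sup_norm"
  proof
    fix x y :: "nat \<Rightarrow> 'a" assume y: "y \<in> M"
    {
      assume le: "\<And>n. norm (x n) \<le> norm (y n)"
      show "x \<in> M" by (rule A.solid_mem[OF y le])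
      show "sup_norm x \<le> sup_norm y" by (rule sup_norm_le) (rule order_trans[OF le up[OF y]])
    next
      assume eqm: "equimeasurable x y"
      show x: "x \<in> M" using equimeasurable_norm_le[OF eqm up[OF y]] unfolding bdd by blast
      show "sup_norm x = sup_norm y"
        using eq_le[OF eqm y] eq_le[OF equimeasurable_sym[OF eqm] x] by (rule antisym)
    }
  qed (rule A.finite_support_mem)
qed

end

section \<open>Rearrangement invariance of the multiplier space\<close>

theorem lemma6p5:
  fixes X Y :: "(nat \<Rightarrow> 'a :: {real_normed_field, banach}) set"
    and nX nY :: "(nat \<Rightarrow> 'a) \<Rightarrow> real"
  assumes "ri_sequence_space X nX" and "fatou_property X nX"
    and "ri_sequence_space Y nY" and "fatou_property Y nY"
  shows "\<exists>N. ri_sequence_space (multipliers X Y) N \<and>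
             equivalent_norms_on (multipliers X Y) (multiplier_norm X nX nY) N"
proof -
  interpret ri_pair X Y nX nY using assms by (simp add: ri_pair_def)
  show ?thesis
  proof (cases "\<forall>g\<in>M. \<forall>t>0. finite {n. t < norm (g n)}")
    case True
    have "equivalent_norms_on M nM nM"
      unfolding equivalent_norms_on_def by (intro exI[of _ 1] conjI) auto
    then show ?thesis using ri_multipliers_if_null True by blast
  next
    case False
    then have "(\<lambda>n. 1) \<in> M" using one_multiplier by blast
    then show ?thesis using ri_multipliers_sup_norm by blast
  qed
qed

end
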